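(* We have $$C_{1324,4321}(x)=\left(1+\sum_{k\ge 1}\frac{x^k}{1-x^k}+\sum_{k\ge 1}\sum_{i\ge k+1}\frac{x^{k+i}}{(1-x^k)(1-x^i)}\right)^2.$$
   Context: $\mathrm{av}_n^k(B)$ is the number of permutations in $S_n$ with exactly $k$ inversions (pairs $i<j$ with $\pi_i>\pi_j$) that avoid every pattern in $B$; a permutation avoids a pattern $q$ if it has no subsequence order-isomorphic to $q$. If for every $k\ge0$ there are constants $m_k,c_k(B)$ with $\mathrm{av}_n^k(B)=c_k(B)$ for all $n\ge m_k$, then $(c_k(B))_{k\ge0}$ is the limit sequence of $B$ and $C_B(x)=\sum_{k\ge 0}c_k(B)x^k$ is its limit generating function (a formal power series); here $B=\{1324,4321\}$. *)

theory Defs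
  imports
    "HOL-Analysis.Infinite_Sum"
    "HOL-Library.Sublist"
    "HOL-Combinatorics.Multiset_Permutations"
    "HOL-Computational_Algebra.Formal_Power_Series"
begin

text \<open>
  Permutations of \<open>{1..n}\<close> and patterns are lists in one-line notation;
  \<open>S\<^sub>n\<close> is \<^term>\<open>permutations_of_set {1..n::nat}\<close>.
\<close>

definition order_isomorphic :: "nat list \<Rightarrow> nat list \<Rightarrow> bool" where
  "order_isomorphic xs ys \<longleftrightarrow> length xs = length ys \<and>
     (\<forall>i<length xs. \<forall>j<length xs. xs ! i < xs ! j \<longleftrightarrow> ys ! i < ys ! j)"

text \<open>Here \<^const>\<open>subseq\<close> is the relation of being a not necessarily contiguous subsequence.\<close>

definition contains_pattern :: "nat list \<Rightarrow> nat list \<Rightarrow> bool" where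
  "contains_pattern p q \<longleftrightarrow> (\<exists>s. subseq s p \<and> order_isomorphic s q)"

definition avoids :: "nat list \<Rightarrow> nat list set \<Rightarrow> bool" where
  "avoids p B \<longleftrightarrow> (\<forall>q\<in>B. \<not> contains_pattern p q)"

definition inversions :: "nat list \<Rightarrow> (nat \<times> nat) set" where
  "inversions p = {(i, j). i < j \<and> j < length p \<and> p ! i > p ! j}"

definition av :: "nat \<Rightarrow> nat \<Rightarrow> nat list set \<Rightarrow> nat" where
  "av n k B = card {p \<in> permutations_of_set {1..n}. card (inversions p) = k \<and> avoids p B}"

definition has_limit_sequence :: "nat list set \<Rightarrow> bool" where
  "has_limit_sequence B \<longleftrightarrow> (\<forall>k. \<exists>c m. \<forall>n\<ge>m. av n k B = c)"

text \<open>Only meaningful if \<^term>\<open>has_limit_sequence B\<close>.\<close>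

definition limit_sequence :: "nat list set \<Rightarrow> nat \<Rightarrow> nat" where
  "limit_sequence B k = (THE c. \<exists>m. \<forall>n\<ge>m. av n k B = c)"

definition limit_gf :: "nat list set \<Rightarrow> rat fps" where
  "limit_gf B = Abs_fps (\<lambda>k. of_nat (limit_sequence B k))"

end

theory Submission
  imports Defs
begin

text \<open>
  Let \<open>p\<close> avoid 1324 and have \<open>k\<close> inversions. An inversion cannot have both an entry to its lower left
  and one to its upper right, and then counting inversions shows that it lies within the first or the
  last \<open>k + 1\<close> positions. So if \<open>n \<ge> 2k + 2\<close>, then \<open>p\<close> splits after position \<open>k + 1\<close> as a direct sum of \<open>s\<close>
  and \<open>t\<close>, where \<open>s\<close> avoids 132 and \<open>t\<close> avoids 213; moreover \<open>p\<close> avoids 4321 iff both \<open>s\<close> and \<open>t\<close> do.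
  Reverse-complement turns 213 into 132, which explains the square.

  A permutation avoids 132 iff its Lehmer code is weakly decreasing, that is, a partition of the
  number of inversions padded with zeros. Its left-to-right minima sit where the code takes a new
  value, so its longest decreasing subsequence is as long as its code has different values. Hence
  avoiding 4321 means having at most two different nonzero parts.
\<close>

subsection \<open>Lehmer codes of 132-avoiders\<close>

fun lehmer :: "nat list \<Rightarrow> nat list" where
  "lehmer [] = []"
| "lehmer (x # xs) = card {y \<in> set xs. y < x} # lehmer xs"

lemma length_lehmer [simp]: "length (lehmer p) = length p"
  by (induction p) auto

text \<open>The recursion compares values with the tail, so that codes make sense over any finite
  set of values. This is the equivalent form on positions, in which entry \<open>i\<close> counts
  the inversions starting at \<open>i\<close>.\<close>

lemma lehmer_nth:
  assumes "distinct p" "i < length p"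
  shows "lehmer p ! i = card {j. i < j \<and> j < length p \<and> p ! j < p ! i}"
  using assms
proof (induction p arbitrary: i)
  case (Cons x xs)
  show ?case
  proof (cases i)
    case 0
    have "{j. 0 < j \<and> j < length (x # xs) \<and> (x # xs) ! j < x} = Suc ` {j. j < length xs \<and> xs ! j < x}"
      by (force simp: image_iff gr0_conv_Suc)
    moreover have "card {y \<in> set xs. y < x} = card {j. j < length xs \<and> xs ! j < x}"
    proof (rule bij_betw_same_card[symmetric])
      show "bij_betw ((!) xs) {j. j < length xs \<and> xs ! j < x} {y \<in> set xs. y < x}"
        using Cons.prems by (auto simp: bij_betw_def inj_on_def nth_eq_iff_index_eq in_set_conv_nth)
    qed
    ultimately show ?thesis
      using 0 by (simp add: card_image)
  next
    case (Suc i')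
    have "{j. i < j \<and> j < length (x # xs) \<and> (x # xs) ! j < (x # xs) ! i} =
        Suc ` {j. i' < j \<and> j < length xs \<and> xs ! j < xs ! i'}"
    proof (intro set_eqI iffI)
      fix j assume "j \<in> {j. i < j \<and> j < length (x # xs) \<and> (x # xs) ! j < (x # xs) ! i}"
      then show "j \<in> Suc ` {j. i' < j \<and> j < length xs \<and> xs ! j < xs ! i'}"
        using Suc by (cases j) auto
    qed (use Suc in auto)
    then show ?thesis
      using Suc Cons by (simp add: card_image)
  qed
qed simp

lemma finite_inversions [simp]: "finite (inversions p)"
  by (rule finite_subset[of _ "{..<length p} \<times> {..<length p}"]) (auto simp: inversions_def)

lemma sum_list_lehmer:
  assumes "distinct p"
  shows "sum_list (lehmer p) = card (inversions p)"
proof -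
  have "inversions p = (SIGMA i:{..<length p}. {j. i < j \<and> j < length p \<and> p ! j < p ! i})"
    by (auto simp: inversions_def)
  then show ?thesis
    using lehmer_nth[OF assms] by (simp add: sum_list_sum_nth atLeast0LessThan)
qed

lemma card_less_if_subset_mem:
  assumes "finite B" "A \<subseteq> B" "x \<in> B" "x \<notin> A"
  shows "card A < card B"
  using assms by (metis psubset_card_mono psubsetI)

lemma card_less_inj:
  fixes x y :: nat
  assumes "finite A" "x \<in> A" "y \<in> A" "card {z \<in> A. z < x} = card {z \<in> A. z < y}"
  shows "x = y"
proof -
  have less: "card {z \<in> A. z < x} < card {z \<in> A. z < y}" if "x \<in> A" "x < y" for x y
    by (rule card_less_if_subset_mem[of _ _ x]) (use that assms(1) in auto)
  show ?thesis
    using less[of x y] less[of y x] assms by (cases x y rule: linorder_cases) auto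
qed

text \<open>The head of a code is the rank of the first letter among the values still available, and
  the tail is the code of the remaining letters over the set without that letter. Removing a letter
  leaves no interval, hence the general finite set \<open>A\<close>.\<close>

lemma bij_betw_lehmer:
  assumes "finite A"
  shows "bij_betw lehmer (permutations_of_set A) {c. length c = card A \<and> (\<forall>i<card A. c ! i + i < card A)}"
proof -
  have *: "{y \<in> A. y < x} = {y \<in> A - {x}. y < x}" for A and x :: nat
    by auto
  have inj: "p = q" if "p \<in> permutations_of_set A" "q \<in> permutations_of_set A" "lehmer p = lehmer q" for p q
    using that assms
  proof (induction p arbitrary: A q)
    case Nil
    then show ?case by (cases q) auto
  next
    case (Cons x xs)
    then obtain y ys where q: "q = y # ys"
      by (cases q) auto
    have xs: "x \<in> A" "set xs = A - {x}" "distinct xs" and ys: "y \<in> A" "set ys = A - {y}" "distinct ys"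
      using Cons.prems unfolding q permutations_of_set_def by auto
    have "card {z \<in> A. z < x} = card {z \<in> A. z < y}"
      using Cons.prems xs ys *[of A x] *[of A y] unfolding q by simp
    then have "x = y"
      using card_less_inj[OF \<open>finite A\<close>] xs ys by blast
    moreover have "xs = ys"
      using Cons.IH[of "A - {x}" ys] Cons.prems xs ys \<open>x = y\<close> unfolding q by auto
    ultimately show ?case
      using q by simp
  qed
  have bound: "lehmer p ! i + i < length p" if "distinct p" "i < length p" for p i
  proof -
    have "card {j. i < j \<and> j < length p \<and> p ! j < p ! i} \<le> card {i<..<length p}"
      by (rule card_mono) auto
    then show ?thesis
      using lehmer_nth[OF that] that by simp
  qed
  have surj: "\<exists>p \<in> permutations_of_set A. lehmer p = c"
    if "length c = card A" "\<forall>i<card A. c ! i + i < card A" for c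
    using that assms
  proof (induction c arbitrary: A)
    case (Cons r c)
    \<comment> \<open>The first letter must have exactly \<open>r\<close> smaller ones in
      \<open>A\<close>, which is the entry with index \<open>r\<close>, counted from 0, in sorted
      order.\<close>
    define x where "x = sorted_list_of_set A ! r"
    have r: "r < card A"
      using Cons.prems by fastforce
    then have x: "x \<in> A"
      unfolding x_def using Cons.prems
      by (metis nth_mem set_sorted_list_of_set sorted_list_of_set.length_sorted_key_list_of_set)
    have "{y \<in> A. y < x} = (!) (sorted_list_of_set A) ` {..<r}"
    proof (intro set_eqI iffI)
      fix y assume "y \<in> {y \<in> A. y < x}"
      then obtain j where j: "j < card A" "y = sorted_list_of_set A ! j" "y < x"
        by (metis (mono_tags, lifting) Cons.prems(3) in_set_conv_nth mem_Collect_eq set_sorted_list_of_set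
            sorted_list_of_set.length_sorted_key_list_of_set)
      then have "j < r"
        unfolding x_def using r Cons.prems(3)
        by (metis linorder_not_less sorted_list_of_set.length_sorted_key_list_of_set sorted_nth_mono
            sorted_list_of_set.sorted_sorted_key_list_of_set)
      then show "y \<in> (!) (sorted_list_of_set A) ` {..<r}"
        using j by auto
    next
      fix y assume "y \<in> (!) (sorted_list_of_set A) ` {..<r}"
      then obtain j where "j < r" "y = sorted_list_of_set A ! j"
        by auto
      then show "y \<in> {y \<in> A. y < x}"
        using r Cons.prems(3) sorted_wrt_nth_less[OF strict_sorted_list_of_set[of A], of j r]
          nth_mem[of j "sorted_list_of_set A"]
        by (auto simp: x_def)
    qed
    moreover have "inj_on ((!) (sorted_list_of_set A)) {..<r}"
      using r by (auto simp: inj_on_def nth_eq_iff_index_eq)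
    ultimately have card: "card {y \<in> A. y < x} = r"
      by (simp add: card_image)
    have "c ! i + i < card (A - {x})" if "i < card (A - {x})" for i
    proof -
      have "Suc i < card A"
        using that x Cons.prems(3) by simp
      then show ?thesis
        using Cons.prems(2)[rule_format, of "Suc i"] x Cons.prems(3) by simp
    qed
    moreover have "length c = card (A - {x})"
      using Cons.prems(1) x \<open>finite A\<close> by (metis card_Diff_singleton diff_Suc_1 length_Cons)
    ultimately obtain p where p: "p \<in> permutations_of_set (A - {x})" "lehmer p = c"
      using Cons.IH[of "A - {x}"] \<open>finite A\<close> by blast
    then show ?case
      using x card *[of A x]
      by (intro bexI[of _ "x # p"]) (auto simp: permutations_of_set_def)
  qed simp
  show ?thesis
    unfolding bij_betw_def
  proof
    show "inj_on lehmer (permutations_of_set A)"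
      using inj by (auto simp: inj_on_def)
    show "lehmer ` permutations_of_set A = {c. length c = card A \<and> (\<forall>i<card A. c ! i + i < card A)}"
    proof (intro equalityI subsetI)
      fix c assume "c \<in> lehmer ` permutations_of_set A"
      then obtain p where p: "c = lehmer p" "distinct p" "set p = A"
        by (auto simp: permutations_of_set_def)
      then have "length p = card A"
        using distinct_card[of p] by simp
      then show "c \<in> {c. length c = card A \<and> (\<forall>i<card A. c ! i + i < card A)}"
        using p bound[OF p(2)] by simp
    next
      fix c assume "c \<in> {c. length c = card A \<and> (\<forall>i<card A. c ! i + i < card A)}"
      then show "c \<in> lehmer ` permutations_of_set A"
        using surj by blast
    qed
  qed
qed

section \<open>The patterns 132 and 4321 in terms of the code\<close>

definition has_132 :: "nat list \<Rightarrow> bool" where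
  "has_132 p \<longleftrightarrow> (\<exists>i j l. i < j \<and> j < l \<and> l < length p \<and> p ! i < p ! l \<and> p ! l < p ! j)"

definition has_4321 :: "nat list \<Rightarrow> bool" where
  "has_4321 p \<longleftrightarrow> (\<exists>i j k l. i < j \<and> j < k \<and> k < l \<and> l < length p \<and>
     p ! i > p ! j \<and> p ! j > p ! k \<and> p ! k > p ! l)"

text \<open>Whatever is counted for \<open>j\<close> is also counted for \<open>i\<close>, and
  \<open>j\<close> itself is counted for \<open>i\<close> only.\<close>

lemma lehmer_less_if_inversion:
  assumes "distinct p" "i < j" "j < length p" "p ! i > p ! j"
  shows "lehmer p ! i > lehmer p ! j"
proof -
  have "card {l. j < l \<and> l < length p \<and> p ! l < p ! j} < card {l. i < l \<and> l < length p \<and> p ! l < p ! i}"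
    by (rule card_less_if_subset_mem[of _ _ j]) (use assms in auto)
  then show ?thesis
    using assms by (simp add: lehmer_nth)
qed

text \<open>Nothing up to position \<open>j\<close> lies below \<open>p ! i\<close>, so all that is
  counted for \<open>i\<close> comes after \<open>j\<close>. An inclusion of sets is kept instead of
  an inequality of codes, so that one extra element of the larger set makes the inequality
  strict.\<close>

lemma lehmer_le_if_between_greater:
  fixes p :: "nat list"
  assumes "distinct p" "i < j" "j < length p" "p ! i < p ! j"
    and "\<And>l. i < l \<Longrightarrow> l < j \<Longrightarrow> p ! i < p ! l"
  shows "{l. i < l \<and> l < length p \<and> p ! l < p ! i} \<subseteq> {l. j < l \<and> l < length p \<and> p ! l < p ! j}"
proof safe
  fix l assume l: "i < l" "l < length p" "p ! l < p ! i"
  show "j < l"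
    using assms(4) assms(5)[of l] l by (cases l j rule: linorder_cases) auto
  show "p ! l < p ! j"
    using assms(4) l by simp
qed

text \<open>The code drops along an inversion anyway. For \<open>i < j\<close> with
  \<open>p ! i < p ! j\<close>, avoiding 132 forces every later entry below \<open>p ! j\<close> to
  be below \<open>p ! i\<close> as well, so the code cannot rise. Conversely, a 132 whose first
  position is chosen as far right as possible makes the code rise from its 1 to its 3.\<close>

lemma not_has_132_iff_lehmer:
  assumes "distinct p"
  shows "\<not> has_132 p \<longleftrightarrow> sorted_wrt (\<ge>) (lehmer p)"
proof
  assume no: "\<not> has_132 p"
  show "sorted_wrt (\<ge>) (lehmer p)"
    unfolding sorted_wrt_iff_nth_less
  proof safe
    fix i j assume ij: "i < j" "j < length (lehmer p)"
    show "lehmer p ! j \<le> lehmer p ! i"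
    proof (cases "p ! j < p ! i")
      case True
      then show ?thesis
        using lehmer_less_if_inversion[OF assms, of i j] ij by simp
    next
      case False
      then have "p ! i < p ! j"
        using assms ij by (simp add: nth_eq_iff_index_eq order_less_le)
      have "p ! l < p ! i" if "j < l" "l < length p" "p ! l < p ! j" for l
      proof -
        have "p ! l \<noteq> p ! i"
          using assms that ij by (simp add: nth_eq_iff_index_eq)
        then show ?thesis
          using no that ij unfolding has_132_def by (meson linorder_neqE_nat)
      qed
      then have "card {l. j < l \<and> l < length p \<and> p ! l < p ! j} \<le> card {l. i < l \<and> l < length p \<and> p ! l < p ! i}"
        by (intro card_mono) (use ij in auto)
      then show ?thesis
        using assms ij by (simp add: lehmer_nth)
    qed
  qed
next
  assume dec: "sorted_wrt (\<ge>) (lehmer p)"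
  show "\<not> has_132 p"
  proof
    assume "has_132 p"
    then obtain i0 j l where i0: "i0 < j \<and> p ! i0 < p ! l" and jl: "j < l" "l < length p" "p ! l < p ! j"
      unfolding has_132_def by blast
    \<comment> \<open>The rightmost choice puts all entries strictly between \<open>i\<close> and
      \<open>j\<close> above \<open>p ! l\<close>, hence above \<open>p ! i\<close>. Position
      \<open>l\<close> is then counted for \<open>j\<close> but not for \<open>i\<close>.\<close>
    define i where "i = (GREATEST i. i < j \<and> p ! i < p ! l)"
    have i: "i < j \<and> p ! i < p ! l"
      unfolding i_def by (rule GreatestI_nat[where P = "\<lambda>i. i < j \<and> p ! i < p ! l" and b = j, OF i0]) simp
    have "p ! m > p ! l" if "i < m" "m < j" for m
    proof -
      have "\<not> p ! m < p ! l"
        using that Greatest_le_nat[of "\<lambda>i. i < j \<and> p ! i < p ! l" m j] by (fastforce simp: i_def)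
      then show ?thesis
        using assms that jl by (simp add: nth_eq_iff_index_eq order_less_le)
    qed
    then have "{m. i < m \<and> m < length p \<and> p ! m < p ! i} \<subseteq> {m. j < m \<and> m < length p \<and> p ! m < p ! j}"
      using assms i jl by (intro lehmer_le_if_between_greater) (auto intro: less_trans)
    moreover have "l \<in> {m. j < m \<and> m < length p \<and> p ! m < p ! j}" "l \<notin> {m. i < m \<and> m < length p \<and> p ! m < p ! i}"
      using i jl by auto
    ultimately have "card {m. i < m \<and> m < length p \<and> p ! m < p ! i} < card {m. j < m \<and> m < length p \<and> p ! m < p ! j}"
      by (intro card_less_if_subset_mem[of _ _ l]) auto
    then have "lehmer p ! i < lehmer p ! j"
      using assms i jl by (simp add: lehmer_nth)
    moreover have "lehmer p ! j \<le> lehmer p ! i"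
      using dec i jl by (simp add: sorted_wrt_iff_nth_less)
    ultimately show False
      by simp
  qed
qed

text \<open>Positions at which the weakly decreasing Lehmer code takes a value for the first time are
  left-to-right minima.\<close>

lemma inversion_if_lehmer_first:
  assumes "distinct p" "j < length p" "\<And>i. i < j \<Longrightarrow> lehmer p ! i > lehmer p ! j" "i < j"
  shows "p ! i > p ! j"
proof (rule ccontr)
  assume "\<not> p ! i > p ! j"
  then have i: "i < j \<and> p ! i < p ! j"
    using assms by (simp add: nth_eq_iff_index_eq order_less_le)
  \<comment> \<open>Of the entries before \<open>j\<close> that are below \<open>p ! j\<close>, the
    last one has a code of at most that of \<open>j\<close>, although all earlier codes are assumed
    to be larger.\<close>
  define i' where "i' = (GREATEST i. i < j \<and> p ! i < p ! j)"
  have i': "i' < j \<and> p ! i' < p ! j"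
    unfolding i'_def by (rule GreatestI_nat[where P = "\<lambda>i. i < j \<and> p ! i < p ! j" and b = j, OF i]) simp
  have "\<not> p ! m < p ! j" if "i' < m" "m < j" for m
    using that Greatest_le_nat[of "\<lambda>i. i < j \<and> p ! i < p ! j" m j] by (fastforce simp: i'_def)
  then have "{m. i' < m \<and> m < length p \<and> p ! m < p ! i'} \<subseteq> {m. j < m \<and> m < length p \<and> p ! m < p ! j}"
    using assms i' by (intro lehmer_le_if_between_greater) (auto simp: not_less intro: less_le_trans)
  then have "lehmer p ! i' \<le> lehmer p ! j"
    using assms i' by (simp add: lehmer_nth card_mono)
  then show False
    using assms(3) i' by force
qed

text \<open>Codes drop strictly along a decreasing subsequence, so a 4321 shows four values.
  Conversely, the first occurrences of four values are left-to-right minima, and these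
  decrease.\<close>

lemma has_4321_iff_lehmer:
  assumes "distinct p" and dec: "sorted_wrt (\<ge>) (lehmer p)"
  shows "has_4321 p \<longleftrightarrow> card (set (lehmer p)) \<ge> 4"
proof
  assume "has_4321 p"
  then obtain i j k l where *: "i < j" "j < k" "k < l" "l < length p" "p ! i > p ! j" "p ! j > p ! k" "p ! k > p ! l"
    unfolding has_4321_def by blast
  let ?c = "\<lambda>i. lehmer p ! i"
  have "?c i > ?c j" "?c j > ?c k" "?c k > ?c l"
    using * assms by (auto intro: lehmer_less_if_inversion)
  then have "card {?c i, ?c j, ?c k, ?c l} = 4"
    by auto
  moreover have "{?c i, ?c j, ?c k, ?c l} \<subseteq> set (lehmer p)"
    using * by auto
  ultimately show "card (set (lehmer p)) \<ge> 4"
    by (metis List.finite_set card_mono)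
next
  assume ge: "card (set (lehmer p)) \<ge> 4"
  define f where "f v = (LEAST i. i < length p \<and> lehmer p ! i = v)" for v
  have f: "f v < length p \<and> lehmer p ! f v = v" if "v \<in> set (lehmer p)" for v
    unfolding f_def using that by (intro LeastI_ex[of "\<lambda>i. i < length p \<and> lehmer p ! i = v"]) (auto simp: in_set_conv_nth)
  have less: "f v < f w \<and> p ! f v > p ! f w"
    if "v \<in> set (lehmer p)" "w \<in> set (lehmer p)" "v > w" for v w
  proof -
    have "f v < f w"
    proof (rule ccontr)
      assume "\<not> f v < f w"
      then have "f w < f v"
        using f[OF that(1)] f[OF that(2)] that(3) by (cases "f v" "f w" rule: linorder_cases) auto
      then have "lehmer p ! f v \<le> lehmer p ! f w"
        using sorted_wrt_nth_less[OF dec, of "f w" "f v"] f[OF that(1)] by simp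
      then show False
        using f[OF that(1)] f[OF that(2)] that(3) by simp
    qed
    moreover have "p ! f v > p ! f w"
    proof (rule inversion_if_lehmer_first[OF assms(1)])
      fix i assume i: "i < f w"
      then have "lehmer p ! i \<noteq> w"
        using not_less_Least[of i "\<lambda>i. i < length p \<and> lehmer p ! i = w"] f[OF that(2)] by (auto simp: f_def)
      moreover have "lehmer p ! i \<ge> w"
        using dec i f[OF that(2)] by (metis length_lehmer sorted_wrt_iff_nth_less)
      ultimately show "lehmer p ! f w < lehmer p ! i"
        using f[OF that(2)] by simp
    qed (use calculation f that in auto)
    ultimately show ?thesis ..
  qed
  define s where "s = sorted_list_of_set (set (lehmer p))"
  have s: "length s \<ge> 4" "set s = set (lehmer p)" "sorted_wrt (<) s"
    using ge by (auto simp: s_def)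
  have "s ! 0 < s ! 1" "s ! 1 < s ! 2" "s ! 2 < s ! 3"
    using s by (auto intro: sorted_wrt_nth_less)
  moreover have "s ! i \<in> set (lehmer p)" if "i < 4" for i
    using s that by (metis nth_mem order_less_le_trans)
  \<comment> \<open>\<open>s\<close> increases while larger code values occur earlier, so the
    witnesses are taken in reverse order.\<close>
  ultimately show "has_4321 p"
    unfolding has_4321_def using less f
    by (intro exI[of _ "f (s ! 3)"] exI[of _ "f (s ! 2)"] exI[of _ "f (s ! 1)"] exI[of _ "f (s ! 0)"]) auto
qed

subsection \<open>Generating function of partitions with at most two part sizes\<close>

text \<open>Convergence is coefficientwise. Finiteness of the \<open>SIGMA\<close> set lets only
  finitely many \<open>k\<close> contribute to coefficient \<open>n\<close>, where the sum of
  cardinalities is that of a disjoint union.\<close>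

lemma infsum_fps_card:
  fixes S :: "'k \<Rightarrow> nat \<Rightarrow> 'b set"
  assumes "\<And>n. finite (SIGMA k:A. S k n)"
  shows "(\<Sum>\<^sub>\<infinity>k\<in>A. Abs_fps (\<lambda>n. of_nat (card (S k n)))) =
    (Abs_fps (\<lambda>n. of_nat (card (SIGMA k:A. S k n))) :: 'a :: ring_char_0 fps)"
proof (rule infsumI, rule has_sum_fpsI, goal_cases)
  case (1 n)
  have "{k \<in> A. S k n \<noteq> {}} \<subseteq> fst ` (SIGMA k:A. S k n)"
    by force
  then have "finite {k \<in> A. S k n \<noteq> {}}"
    by (rule finite_subset) (use assms in auto)
  then show ?case
    by (rule rev_finite_subset) auto
next
  case (2 n)
  have fin: "finite (S k n)" if "k \<in> A" for k
  proof -
    have "Pair k ` S k n \<subseteq> (SIGMA k:A. S k n)"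
      using that by auto
    then have "finite (Pair k ` S k n)"
      using assms finite_subset by blast
    then show ?thesis
      by (rule finite_imageD) (auto simp: inj_on_def)
  qed
  define A' where "A' = {k \<in> A. card (S k n) \<noteq> 0}"
  have "A' \<subseteq> fst ` (SIGMA k:A. S k n)"
    by (force simp: A'_def card_eq_0_iff)
  then have finA': "finite A'"
    by (rule finite_subset) (use assms in auto)
  have "(SIGMA k:A. S k n) = (SIGMA k:A'. S k n)"
    using fin by (auto simp: A'_def card_eq_0_iff)
  also have "card \<dots> = (\<Sum>k\<in>A'. card (S k n))"
    by (rule card_SigmaI) (use finA' fin in \<open>auto simp: A'_def\<close>)
  finally show ?case
    by (simp add: A'_def)
qed

text \<open>This is the geometric series in \<open>fps_X ^ k\<close> without its constant term,
  checked by multiplying back with \<open>1 - fps_X ^ k\<close>.\<close>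

lemma fps_X_power_div_one_minus:
  assumes "k \<ge> 1"
  shows "fps_X ^ k / (1 - fps_X ^ k) =
    (Abs_fps (\<lambda>n. of_nat (card {a. 1 \<le> a \<and> k * a = n})) :: 'a :: field fps)"
proof -
  define P :: "'a fps" where "P = Abs_fps (\<lambda>n. of_nat (card {a. 1 \<le> a \<and> k * a = n}))"
  have P: "fps_nth P n = (if 0 < n \<and> k dvd n then 1 else 0)" for n
  proof (cases "0 < n \<and> k dvd n")
    case True
    then have "{a. 1 \<le> a \<and> k * a = n} = {n div k}"
      using assms by auto
    then show ?thesis
      using True by (simp add: P_def)
  next
    case False
    then have "{a. 1 \<le> a \<and> k * a = n} = {}"
      using assms by auto
    then show ?thesis
      using False by (simp add: P_def del: Collect_empty_eq)
  qed
  have "P * (1 - fps_X ^ k) = fps_X ^ k"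
  proof (rule fps_ext)
    fix n
    show "fps_nth (P * (1 - fps_X ^ k)) n = fps_nth (fps_X ^ k) n"
      using assms
      by (auto simp: algebra_simps fps_X_power_mult_nth fps_X_power_mult_right_nth P dvd_minus_self
          dest: dvd_imp_le)
  qed
  moreover have "fps_nth (1 - fps_X ^ k :: 'a fps) 0 \<noteq> 0"
    using assms by simp
  then have "1 - fps_X ^ k \<noteq> (0 :: 'a fps)"
    by (metis fps_zero_nth)
  ultimately show ?thesis
    unfolding P_def[symmetric] by (metis nonzero_mult_div_cancel_right)
qed

text \<open>The Cauchy product counts pairs whose weights add up to \<open>n\<close>. Disjointness
  of the family \<open>S\<close> keeps the products for different \<open>i\<close> apart.\<close>

lemma fps_card_mult:
  assumes "\<And>n. finite (S n)" "\<And>n. finite (T n)" "disjoint_family S"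
  shows "Abs_fps (\<lambda>n. of_nat (card (S n))) * Abs_fps (\<lambda>n. of_nat (card (T n))) =
    (Abs_fps (\<lambda>n. of_nat (card (\<Union>i\<le>n. S i \<times> T (n - i)))) :: 'a :: semiring_1 fps)"
proof (rule fps_ext)
  fix n
  have "card (\<Union>i\<le>n. S i \<times> T (n - i)) = (\<Sum>i\<le>n. card (S i \<times> T (n - i)))"
    by (rule card_UN_disjoint) (use assms in \<open>auto simp: disjoint_family_on_def Times_Int_Times\<close>)
  then show "fps_nth (Abs_fps (\<lambda>n. of_nat (card (S n))) * Abs_fps (\<lambda>n. of_nat (card (T n)))) n =
    (fps_nth (Abs_fps (\<lambda>n. of_nat (card (\<Union>i\<le>n. S i \<times> T (n - i))))) n :: 'a)"
    by (simp add: fps_mult_nth card_cartesian_product atLeast0AtMost)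
qed

text \<open>Both factors of the denominator are units, so the fraction is a product of two geometric
  series.\<close>

lemma fps_X_power_div_one_minus_mult:
  assumes "k \<ge> 1" "i \<ge> 1"
  shows "fps_X ^ (k + i) / ((1 - fps_X ^ k) * (1 - fps_X ^ i)) =
    (Abs_fps (\<lambda>n. of_nat (card {(a, b). 1 \<le> a \<and> 1 \<le> b \<and> k * a + i * b = n})) :: 'a :: field fps)"
proof -
  let ?S = "\<lambda>(k :: nat) (n :: nat). {a :: nat. 1 \<le> a \<and> k * a = n}"
  have fin: "finite (?S k n)" if "k \<ge> 1" for k n :: nat
    by (rule finite_subset[of _ "{..n}"]) (use that in auto)
  have unit: "is_unit (1 - fps_X ^ k :: 'a fps)" if "k \<ge> 1" for k
    using that by simp
  have "fps_X ^ (k + i) / ((1 - fps_X ^ k) * (1 - fps_X ^ i)) =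
      (fps_X ^ k / (1 - fps_X ^ k)) * (fps_X ^ i / (1 - fps_X ^ i) :: 'a fps)"
    using assms unit by (simp add: power_add unit_div_mult_swap is_unit_div_mult2_eq mult.commute div_mult_div_if_dvd)
  also have "\<dots> = Abs_fps (\<lambda>n. of_nat (card (\<Union>j\<le>n. ?S k j \<times> ?S i (n - j))))"
    unfolding fps_X_power_div_one_minus[OF assms(1)] fps_X_power_div_one_minus[OF assms(2)]
    by (rule fps_card_mult) (use fin assms in \<open>auto simp: disjoint_family_on_def\<close>)
  also have "(\<lambda>n. \<Union>j\<le>n. ?S k j \<times> ?S i (n - j)) = (\<lambda>n. {(a, b). 1 \<le> a \<and> 1 \<le> b \<and> k * a + i * b = n})"
    by auto
  finally show ?thesis by meson
qed

text \<open>The number of partitions of \<open>n\<close> with at most two different part sizes: \<open>(k, a)\<close> stands for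
  \<open>a\<close> parts of size \<open>k\<close>, and \<open>(k, i, a, b)\<close> for \<open>a\<close> parts of size \<open>k\<close> and \<open>b\<close> parts of size \<open>i\<close>.\<close>

definition parts_le2 :: "nat \<Rightarrow> nat" where
  "parts_le2 n = (if n = 0 then 1 else 0) + card {(k, a). 1 \<le> k \<and> 1 \<le> a \<and> k * a = n} +
     card {(k, i, a, b). 1 \<le> k \<and> k < i \<and> 1 \<le> a \<and> 1 \<le> b \<and> k * a + i * b = n}"

text \<open>Each summand counts multiplicities for fixed part sizes, and summing over the sizes
  forms the \<open>SIGMA\<close> sets. These are finite because sizes and multiplicities are at most
  \<open>n\<close>.\<close>

lemma parts_le2_gf:
  "1 + (\<Sum>\<^sub>\<infinity>k\<in>{1..}. fps_X ^ k / (1 - fps_X ^ k))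
     + (\<Sum>\<^sub>\<infinity>k\<in>{1..}. \<Sum>\<^sub>\<infinity>i\<in>{k+1..}. fps_X ^ (k + i) / ((1 - fps_X ^ k) * (1 - fps_X ^ i))) =
   (Abs_fps (\<lambda>n. of_nat (parts_le2 n)) :: 'a :: field_char_0 fps)"
proof -
  let ?S = "\<lambda>(k :: nat) (n :: nat). {a :: nat. 1 \<le> a \<and> k * a = n}"
  let ?T = "\<lambda>(k :: nat) (i :: nat) (n :: nat). {(a :: nat, b :: nat). 1 \<le> a \<and> 1 \<le> b \<and> k * a + i * b = n}"
  have le: "a \<le> k * a" "k \<le> k * a" if "1 \<le> a" "1 \<le> k" for a k :: nat
    using that by auto
  have "(\<Sum>\<^sub>\<infinity>k\<in>{1..}. fps_X ^ k / (1 - fps_X ^ k)) =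
      (\<Sum>\<^sub>\<infinity>k\<in>{1..}. Abs_fps (\<lambda>n. of_nat (card (?S k n))) :: 'a fps)"
    by (intro infsum_cong fps_X_power_div_one_minus) auto
  also have "\<dots> = Abs_fps (\<lambda>n. of_nat (card (SIGMA k:{1..}. ?S k n)))"
  proof (rule infsum_fps_card)
    fix n
    have "k \<le> n \<and> a \<le> n" if "(k, a) \<in> (SIGMA k:{1..}. ?S k n)" for k a
      using that le[of a k] by simp
    then have "(SIGMA k:{1..}. ?S k n) \<subseteq> {..n} \<times> {..n}"
      by blast
    then show "finite (SIGMA k:{1..}. ?S k n)"
      by (rule finite_subset) simp
  qed
  also have "(\<lambda>n. SIGMA k:{1..}. ?S k n) = (\<lambda>n. {(k, a). 1 \<le> k \<and> 1 \<le> a \<and> k * a = n})"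
    by auto
  finally have 1: "(\<Sum>\<^sub>\<infinity>k\<in>{1..}. fps_X ^ k / (1 - fps_X ^ k) :: 'a fps) =
      Abs_fps (\<lambda>n. of_nat (card {(k, a). 1 \<le> k \<and> 1 \<le> a \<and> k * a = n}))"
    by meson
  have bnd: "a \<le> n \<and> b \<le> n \<and> k \<le> n \<and> i \<le> n"
    if "1 \<le> k" "1 \<le> i" "1 \<le> a" "1 \<le> b" "k * a + i * b = n" for a b k i n :: nat
    using le[of a k] le[of b i] that by linarith
  have "(\<Sum>\<^sub>\<infinity>i\<in>{k+1..}. fps_X ^ (k + i) / ((1 - fps_X ^ k) * (1 - fps_X ^ i))) =
      (Abs_fps (\<lambda>n. of_nat (card (SIGMA i:{k+1..}. ?T k i n))) :: 'a fps)" if "k \<ge> 1" for k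
  proof -
    have "(\<Sum>\<^sub>\<infinity>i\<in>{k+1..}. fps_X ^ (k + i) / ((1 - fps_X ^ k) * (1 - fps_X ^ i))) =
        (\<Sum>\<^sub>\<infinity>i\<in>{k+1..}. Abs_fps (\<lambda>n. of_nat (card (?T k i n))) :: 'a fps)"
      by (intro infsum_cong fps_X_power_div_one_minus_mult) (use that in auto)
    also have "\<dots> = Abs_fps (\<lambda>n. of_nat (card (SIGMA i:{k+1..}. ?T k i n)))"
    proof (rule infsum_fps_card)
      fix n
      have "i \<le> n \<and> a \<le> n \<and> b \<le> n" if "(i, a, b) \<in> (SIGMA i:{k+1..}. ?T k i n)" for i a b
        using that bnd[of k i a b n] \<open>k \<ge> 1\<close> by simp
      then have "(SIGMA i:{k+1..}. ?T k i n) \<subseteq> {..n} \<times> {..n} \<times> {..n}"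
        by blast
      then show "finite (SIGMA i:{k+1..}. ?T k i n)"
        by (rule finite_subset) simp
    qed
    finally show ?thesis .
  qed
  then have "(\<Sum>\<^sub>\<infinity>k\<in>{1..}. \<Sum>\<^sub>\<infinity>i\<in>{k+1..}. fps_X ^ (k + i) / ((1 - fps_X ^ k) * (1 - fps_X ^ i))) =
      (\<Sum>\<^sub>\<infinity>k\<in>{1..}. Abs_fps (\<lambda>n. of_nat (card (SIGMA i:{k+1..}. ?T k i n))) :: 'a fps)"
    by (intro infsum_cong) auto
  also have "\<dots> = Abs_fps (\<lambda>n. of_nat (card (SIGMA k:{1..}. SIGMA i:{k+1..}. ?T k i n)))"
  proof (rule infsum_fps_card)
    fix n
    have "k \<le> n \<and> i \<le> n \<and> a \<le> n \<and> b \<le> n"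
      if "(k, i, a, b) \<in> (SIGMA k:{1..}. SIGMA i:{k+1..}. ?T k i n)" for k i a b
      using that bnd[of k i a b n] by simp
    then have "(SIGMA k:{1..}. SIGMA i:{k+1..}. ?T k i n) \<subseteq> {..n} \<times> {..n} \<times> {..n} \<times> {..n}"
      by blast
    then show "finite (SIGMA k:{1..}. SIGMA i:{k+1..}. ?T k i n)"
      by (rule finite_subset) simp
  qed
  also have "(\<lambda>n. SIGMA k:{1..}. SIGMA i:{k+1..}. ?T k i n) =
      (\<lambda>n. {(k, i, a, b). 1 \<le> k \<and> k < i \<and> 1 \<le> a \<and> 1 \<le> b \<and> k * a + i * b = n})"
    by auto
  finally have 2: "(\<Sum>\<^sub>\<infinity>k\<in>{1..}. \<Sum>\<^sub>\<infinity>i\<in>{k+1..}. fps_X ^ (k + i) / ((1 - fps_X ^ k) * (1 - fps_X ^ i)) :: 'a fps) =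
      Abs_fps (\<lambda>n. of_nat (card {(k, i, a, b). 1 \<le> k \<and> k < i \<and> 1 \<le> a \<and> 1 \<le> b \<and> k * a + i * b = n}))"
    by meson
  show ?thesis
    unfolding 1 2 by (rule fps_ext) (simp add: parts_le2_def)
qed

subsection \<open>Counting 132- and 4321-avoiders\<close>

lemma sorted_wrt_ge_mset_eq:
  fixes c d :: "'a :: linorder list"
  assumes "sorted_wrt (\<ge>) c" "sorted_wrt (\<ge>) d" "mset c = mset d"
  shows "c = d"
proof -
  have "sorted (rev c)" "sorted (rev d)" "mset (rev c) = mset (rev d)"
    using assms by (simp_all add: sorted_wrt_rev)
  then show ?thesis
    by (metis properties_for_sort rev_is_rev_conv)
qed

text \<open>Each of the \<open>j\<close> entries before a positive entry is at least 1. This gives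
  the bound that makes a weakly decreasing list the code of a permutation.\<close>

lemma nth_add_index_le_sum_list:
  fixes c :: "nat list"
  assumes "sorted_wrt (\<ge>) c" "j < length c" "c ! j > 0"
  shows "c ! j + j \<le> sum_list c"
proof -
  have "j = (\<Sum>l<j. 1)"
    by simp
  also have "\<dots> \<le> (\<Sum>l<j. c ! l)"
  proof (rule sum_mono)
    fix l assume "l \<in> {..<j}"
    then have "c ! j \<le> c ! l"
      using assms sorted_wrt_nth_less[of "(\<ge>)" c l j] by simp
    then show "1 \<le> c ! l"
      using assms by simp
  qed
  finally have "c ! j + j \<le> (\<Sum>l<Suc j. c ! l)"
    by simp
  also have "\<dots> \<le> (\<Sum>l<length c. c ! l)"
    by (rule sum_mono2) (use assms in auto)
  finally show ?thesis
    by (simp add: sum_list_sum_nth atLeast0LessThan)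
qed

lemma sorted_wrt_ge_replicate: "sorted_wrt (\<ge>) (replicate n (x :: 'a :: preorder))"
  by (induction n) auto

lemma count_list_replicate: "count_list (replicate n x) y = (if x = y then n else 0)"
  by (induction n) auto

text \<open>Partitions are padded with zeros to length \<open>m\<close>. If \<open>n < m\<close>, then 0 occurs and accounts for one of
  the three values.\<close>

definition padded_parts_le2 :: "nat \<Rightarrow> nat \<Rightarrow> nat list set" where
  "padded_parts_le2 m n = {c. length c = m \<and> sorted_wrt (\<ge>) c \<and> sum_list c = n \<and> card (set c) \<le> 3}"

text \<open>The code translates all three conditions on \<open>p\<close>. As \<open>n < m\<close>,
  every list in \<open>padded_parts_le2 m n\<close> is a code.\<close>

lemma card_perms_eq_card_parts:
  assumes "n < m"
  shows "card {p \<in> permutations_of_set {1..m}. card (inversions p) = n \<and> \<not> has_132 p \<and> \<not> has_4321 p} =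
    card (padded_parts_le2 m n)"
proof (rule bij_betw_same_card)
  let ?P = "\<lambda>c. sorted_wrt (\<ge>) c \<and> sum_list c = n \<and> card (set c) \<le> 3"
  let ?C = "{c. length c = m \<and> (\<forall>i<m. c ! i + i < m)}"
  have bij: "bij_betw lehmer (permutations_of_set {1..m}) ?C"
    using bij_betw_lehmer[of "{1..m}"] by simp
  have P: "card (inversions p) = n \<and> \<not> has_132 p \<and> \<not> has_4321 p \<longleftrightarrow> ?P (lehmer p)"
    if "p \<in> permutations_of_set {1..m}" for p
  proof -
    have d: "distinct p"
      using that by (simp add: permutations_of_set_def)
    show ?thesis
      using sum_list_lehmer[OF d] not_has_132_iff_lehmer[OF d] has_4321_iff_lehmer[OF d]
      by (auto simp: not_le)
  qed
  \<comment> \<open>A zero entry meets the bound since \<open>i < m\<close>, a positive one since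
    its value plus its index is at most the sum \<open>n\<close>.\<close>
  have "c ! i + i < m" if "length c = m" "?P c" "i < m" for c i
    using nth_add_index_le_sum_list[of c i] that assms by (cases "c ! i = 0") auto
  then have "padded_parts_le2 m n = {c \<in> ?C. ?P c}"
    by (auto simp: padded_parts_le2_def)
  then show "bij_betw lehmer {p \<in> permutations_of_set {1..m}. card (inversions p) = n \<and> \<not> has_132 p \<and> \<not> has_4321 p}
      (padded_parts_le2 m n)"
    using bij_betw_Collect[OF bij, of ?P] P by simp
qed

text \<open>The lists are sorted by their number of different nonzero values, 0, 1 or 2, which
  matches the three summands of \<open>parts_le2\<close>. Nonzero values and their multiplicities
  determine a list; \<open>f1\<close> and \<open>f2\<close> rebuild it.\<close>

lemma card_padded_parts_le2:
  assumes "n < m"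
  shows "card (padded_parts_le2 m n) = parts_le2 n"
proof -
  let ?I1 = "{(k, a). 1 \<le> k \<and> 1 \<le> a \<and> k * a = n}"
  let ?I2 = "{(k, i, a, b). 1 \<le> k \<and> k < i \<and> 1 \<le> a \<and> 1 \<le> b \<and> k * a + i * b = n}"
  define f1 where "f1 = (\<lambda>(k, a). replicate a k @ replicate (m - a) (0 :: nat))"
  \<comment> \<open>The larger part \<open>i\<close> comes first, since the list has to
    decrease.\<close>
  define f2 where "f2 = (\<lambda>(k, i, a, b). replicate b i @ replicate a k @ replicate (m - (a + b)) (0 :: nat))"
  have le: "a \<le> k * a" if "1 \<le> k" for a k :: nat
    using that by simp
  \<comment> \<open>At least one zero of padding remains, so 0 is always among the values of
    \<open>f1 x\<close>, and likewise for \<open>f2 x\<close> below.\<close>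
  have I1: "a < m" if "(k, a) \<in> ?I1" for k a
    using that le[of k a] assms by auto
  have I2: "a + b < m" if "(k, i, a, b) \<in> ?I2" for k i a b
  proof -
    have "a \<le> k * a" "b \<le> i * b"
      using that by (auto intro: le)
    moreover have "k * a + i * b = n"
      using that by simp
    ultimately show ?thesis
      using assms by linarith
  qed
  have f1: "f1 x \<in> padded_parts_le2 m n" "set (f1 x) - {0} = {fst x}" "count_list (f1 x) (fst x) = snd x"
    if "x \<in> ?I1" for x
  proof -
    obtain k a where x: "x = (k, a)"
      by fastforce
    then have "a < m" "1 \<le> k" "1 \<le> a" "k * a = n"
      using I1 that by auto
    moreover from this have "set (f1 x) = {k, 0}"
      by (auto simp: f1_def x)
    ultimately show "f1 x \<in> padded_parts_le2 m n" "set (f1 x) - {0} = {fst x}" "count_list (f1 x) (fst x) = snd x"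
      unfolding padded_parts_le2_def
      by (auto simp: f1_def x sorted_wrt_append sorted_wrt_ge_replicate sum_list_replicate card_insert_if mult.commute
          count_list_append count_list_replicate)
  qed
  have f2: "f2 x \<in> padded_parts_le2 m n" "set (f2 x) - {0} = {k, i}" "count_list (f2 x) k = a" "count_list (f2 x) i = b"
    if "x \<in> ?I2" "x = (k, i, a, b)" for x k i a b
  proof -
    have "a + b < m" "1 \<le> k" "k < i" "1 \<le> a" "1 \<le> b" "k * a + i * b = n"
      using I2[of k i a b] that by auto
    moreover from this have "set (f2 x) = {k, i, 0}"
      by (auto simp: f2_def that)
    ultimately show "f2 x \<in> padded_parts_le2 m n" "set (f2 x) - {0} = {k, i}"
        "count_list (f2 x) k = a" "count_list (f2 x) i = b"
      unfolding padded_parts_le2_def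
      by (auto simp: f2_def that sorted_wrt_append sorted_wrt_ge_replicate sum_list_replicate card_insert_if mult.commute
          count_list_append count_list_replicate)
  qed
  \<comment> \<open>The common length \<open>m\<close> fixes the number of zeros, so the multisets
    agree, and decreasing lists with the same multiset are equal.\<close>
  have eqI: "c = d" if "c \<in> padded_parts_le2 m n" "d \<in> padded_parts_le2 m n"
    "set c - {0} = set d - {0}" "\<And>x. x \<in> set c - {0} \<Longrightarrow> count_list c x = count_list d x" for c d
  proof -
    have *: "length c = count_list c 0 + sum (count_list c) (set c - {0})" for c :: "nat list"
    proof -
      have "length c = sum (count_list c) (insert 0 (set c))"
        by (subst sum_count_set[of c "insert 0 (set c)"]) auto
      also have "\<dots> = count_list c 0 + sum (count_list c) (set c - {0})"
        by (subst sum.insert_remove) auto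
      finally show ?thesis .
    qed
    have "sum (count_list c) (set c - {0}) = sum (count_list d) (set d - {0})"
      using that by (intro sum.cong) auto
    then have 0: "count_list c 0 = count_list d 0"
      using *[of c] *[of d] that by (simp add: padded_parts_le2_def)
    have "count_list c x = count_list d x" for x
    proof (cases "x \<in> set c - {0}")
      case False
      then have "x = 0 \<or> x \<notin> set c \<and> x \<notin> set d"
        using that by blast
      then show ?thesis
        using 0 by (auto simp: count_list_0_iff)
    qed (use that in simp)
    then have "mset c = mset d"
      by (intro multiset_eqI) (simp add: count_mset)
    then show ?thesis
      using that by (intro sorted_wrt_ge_mset_eq) (auto simp: padded_parts_le2_def)
  qed
  have sum_counts: "n = (\<Sum>x\<in>set c - {0}. x * count_list c x)" if "c \<in> padded_parts_le2 m n" for c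
  proof -
    have "n = (\<Sum>x\<in>set c. count_list c x * x)"
      using that sum_list_map_eq_sum_count[of id c] by (simp add: padded_parts_le2_def)
    also have "\<dots> = (\<Sum>x\<in>set c - {0}. x * count_list c x)"
      by (rule sum.mono_neutral_cong_right) auto
    finally show ?thesis .
  qed
  let ?C = "\<lambda>j. {c \<in> padded_parts_le2 m n. card (set c - {0}) = j}"
  define C where "C j = ?C j" for j
  have C0: "?C 0 = (if n = 0 then {replicate m 0} else {})"
  proof (cases "n = 0")
    case True
    have mem: "replicate m 0 \<in> ?C 0"
      using True assms by (auto simp: padded_parts_le2_def sorted_wrt_ge_replicate sum_list_replicate)
    have "?C 0 = {replicate m 0}"
    proof (intro equalityI subsetI)
      fix c assume c: "c \<in> ?C 0"
      have "c = replicate m 0"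
      proof (rule eqI)
        have "set c - {0} = {}"
          using c by simp
        then show "set c - {0} = set (replicate m 0) - {0}"
            "\<And>x. x \<in> set c - {0} \<Longrightarrow> count_list c x = count_list (replicate m 0) x"
          by auto
      qed (use c mem in blast)+
      then show "c \<in> {replicate m 0}"
        by (simp only: singleton_iff)
    qed (use mem in simp)
    then show ?thesis
      unfolding if_P[OF True] .
  next
    case False
    then show ?thesis
      using sum_counts by fastforce
  qed
  have C1: "?C 1 = f1 ` ?I1"
  proof (intro equalityI subsetI)
    fix c assume c: "c \<in> ?C 1"
    then obtain k where k: "set c - {0} = {k}"
      by (auto simp: card_1_singleton_iff)
    have "k \<in> set c - {0}"
      unfolding k by simp
    then have "k \<in> set c" "k \<noteq> 0"
      by simp_all
    then have "count_list c k \<noteq> 0"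
      by (simp add: count_list_0_iff)
    moreover have "n = k * count_list c k"
      using sum_counts[of c] c k by simp
    ultimately have I: "(k, count_list c k) \<in> ?I1"
      using \<open>k \<noteq> 0\<close> by simp
    have "c = f1 (k, count_list c k)"
      by (rule eqI) (use f1[OF I] k c in simp_all)
    then show "c \<in> f1 ` ?I1"
      using I by blast
  next
    fix c assume "c \<in> f1 ` ?I1"
    then obtain x where "x \<in> ?I1" "c = f1 x"
      by blast
    then show "c \<in> ?C 1"
      using f1[of x] by simp
  qed
  have C2: "?C 2 = f2 ` ?I2"
  proof (intro equalityI subsetI)
    fix c assume c: "c \<in> ?C 2"
    then obtain k i where ki: "set c - {0} = {k, i}" "k < i"
      by (smt (verit) card_2_iff insert_commute linorder_neqE_nat mem_Collect_eq)
    have "k \<in> set c - {0}" "i \<in> set c - {0}"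
      unfolding ki(1) by simp_all
    then have "k \<in> set c" "i \<in> set c" "k \<noteq> 0"
      by simp_all
    then have "count_list c k \<noteq> 0" "count_list c i \<noteq> 0"
      by (simp_all add: count_list_0_iff)
    moreover have "n = k * count_list c k + i * count_list c i"
      using sum_counts[of c] c ki by simp
    ultimately have I: "(k, i, count_list c k, count_list c i) \<in> ?I2"
      using \<open>k \<noteq> 0\<close> ki(2) by simp
    have "c = f2 (k, i, count_list c k, count_list c i)"
    proof (rule eqI)
      show "count_list c x = count_list (f2 (k, i, count_list c k, count_list c i)) x" if "x \<in> set c - {0}" for x
      proof -
        have "x = k \<or> x = i"
          using that ki(1) by simp
        then show ?thesis
          using f2(3,4)[OF I refl] by auto
      qed
    qed (use f2[OF I refl] ki(1) c in simp_all)
    then show "c \<in> f2 ` ?I2"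
      using I by blast
  next
    fix c assume "c \<in> f2 ` ?I2"
    then obtain k i a b where x: "(k, i, a, b) \<in> ?I2" "c = f2 (k, i, a, b)"
      by auto
    then show "c \<in> ?C 2"
      using f2[OF x(1) refl] by auto
  qed
  have "padded_parts_le2 m n = (\<Union>j\<in>{..2}. C j)"
  proof -
    have "card (set c - {0}) \<le> 2" if "c \<in> padded_parts_le2 m n" for c
    proof -
      \<comment> \<open>Without a zero the sum \<open>n\<close> would be at least the length
        \<open>m\<close>.\<close>
      have "0 \<in> set c"
      proof (rule ccontr)
        assume "0 \<notin> set c"
        then have "length c \<le> sum_list c"
          using sum_list_mono[of c "\<lambda>_. 1" "\<lambda>x. x"] by (auto simp: sum_list_triv Suc_le_eq intro: gr0I)
        then show False
          using that assms by (simp add: padded_parts_le2_def)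
      qed
      then have "card (set c - {0}) = card (set c) - 1"
        by simp
      moreover have "card (set c) \<le> 3"
        using that by (simp add: padded_parts_le2_def)
      ultimately show ?thesis
        by linarith
    qed
    then show ?thesis
      unfolding C_def by blast
  qed
  moreover have fin: "finite (padded_parts_le2 m n)"
  proof (rule finite_subset)
    show "padded_parts_le2 m n \<subseteq> {c. set c \<subseteq> {..n} \<and> length c = m}"
      by (auto simp: padded_parts_le2_def member_le_sum_list)
  qed (simp add: finite_lists_length_eq)
  moreover have "\<forall>i\<in>{..2}. \<forall>j\<in>{..2}. i \<noteq> j \<longrightarrow> C i \<inter> C j = {}"
    unfolding C_def by blast
  moreover have "\<forall>j\<in>{..2}. finite (C j)"
    using fin by (simp add: C_def)
  ultimately have "card (padded_parts_le2 m n) = (\<Sum>j\<le>2. card (C j))"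
    by (simp only: card_UN_disjoint finite_atMost)
  also have "\<dots> = card (C 0) + card (C 1) + card (C 2)"
    by (simp add: numeral_2_eq_2)
  also have "card (C 0) = (if n = 0 then 1 else 0)"
    unfolding C_def C0 by simp
  also have "card (C 1) = card ?I1"
    unfolding C_def C1
  proof (rule card_image, rule inj_onI)
    fix x y assume "x \<in> ?I1" "y \<in> ?I1" "f1 x = f1 y"
    then show "x = y"
      using f1[of x] f1[of y] by (simp add: prod_eq_iff)
  qed
  also have "card (C 2) = card ?I2"
    unfolding C_def C2
  proof (rule card_image, rule inj_onI)
    fix x y assume xy: "x \<in> ?I2" "y \<in> ?I2" "f2 x = f2 y"
    obtain k i a b k' i' a' b' where x: "x = (k, i, a, b)" "y = (k', i', a', b')"
      using prod_cases4 by metis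
    have "{k, i} = {k', i'}"
      using f2(2)[OF xy(1) x(1)] f2(2)[OF xy(2) x(2)] xy(3) by simp
    \<comment> \<open>\<open>k < i\<close> and \<open>k' < i'\<close> rule out the crosswise
      match.\<close>
    then have "k = k' \<and> i = i'"
      using xy x by (auto simp: doubleton_eq_iff)
    then show "x = y"
      using f2(3,4)[OF xy(1) x(1)] f2(3,4)[OF xy(2) x(2)] xy(3) x by simp
  qed
  finally show ?thesis
    by (simp add: parts_le2_def)
qed

subsection \<open>Patterns, reverse-complement and direct sums\<close>

lemma nths_conv_filter: "nths xs I = map ((!) xs) (filter (\<lambda>i. i \<in> I) [0..<length xs])"
proof -
  have "zip xs [0..<length xs] = map (\<lambda>i. (xs ! i, i)) [0..<length xs]"
    by (rule nth_equalityI) auto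
  then show ?thesis
    by (simp add: nths_def filter_map comp_def)
qed

text \<open>A subsequence is \<open>nths p I\<close> for some index set \<open>I\<close>. Finite
  index sets correspond to strictly increasing lists.\<close>

lemma subseq_iff_indices:
  "subseq s p \<longleftrightarrow> (\<exists>js. sorted_wrt (<) js \<and> set js \<subseteq> {..<length p} \<and> s = map ((!) p) js)"
proof
  assume "subseq s p"
  then obtain I where "s = nths p I"
    by (auto simp: subseq_conv_nths)
  then show "\<exists>js. sorted_wrt (<) js \<and> set js \<subseteq> {..<length p} \<and> s = map ((!) p) js"
    by (intro exI[of _ "filter (\<lambda>i. i \<in> I) [0..<length p]"]) (auto simp: nths_conv_filter sorted_wrt_filter)
next
  assume "\<exists>js. sorted_wrt (<) js \<and> set js \<subseteq> {..<length p} \<and> s = map ((!) p) js"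
  then obtain js where js: "sorted_wrt (<) js" "set js \<subseteq> {..<length p}" "s = map ((!) p) js"
    by blast
  have "filter (\<lambda>i. i \<in> set js) [0..<length p] = js"
    by (rule strict_sorted_equal) (use js in \<open>auto simp: sorted_wrt_filter\<close>)
  then have "s = nths p (set js)"
    using js by (simp add: nths_conv_filter)
  then show "subseq s p"
    by (auto simp: subseq_conv_nths)
qed

lemma contains_pattern_4_iff:
  assumes "length q = 4"
  shows "contains_pattern p q \<longleftrightarrow> (\<exists>i j k l. i < j \<and> j < k \<and> k < l \<and> l < length p \<and>
    order_isomorphic [p ! i, p ! j, p ! k, p ! l] q)"
proof
  assume "contains_pattern p q"
  then obtain js where js: "sorted_wrt (<) js" "set js \<subseteq> {..<length p}" "order_isomorphic (map ((!) p) js) q"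
    by (auto simp: contains_pattern_def subseq_iff_indices)
  moreover from this have "length js = 4"
    using assms by (simp add: order_isomorphic_def)
  then obtain i j k l where "js = [i, j, k, l]"
    by (auto simp: numeral_eq_Suc length_Suc_conv)
  ultimately show "\<exists>i j k l. i < j \<and> j < k \<and> k < l \<and> l < length p \<and>
      order_isomorphic [p ! i, p ! j, p ! k, p ! l] q"
    by auto
next
  assume "\<exists>i j k l. i < j \<and> j < k \<and> k < l \<and> l < length p \<and>
      order_isomorphic [p ! i, p ! j, p ! k, p ! l] q"
  then obtain i j k l where *: "i < j" "j < k" "k < l" "l < length p"
      "order_isomorphic (map ((!) p) [i, j, k, l]) q"
    by auto
  then show "contains_pattern p q"
    unfolding contains_pattern_def subseq_iff_indices
    by (intro exI[of _ "map ((!) p) [i, j, k, l]"] conjI exI[of _ "[i, j, k, l]"]) auto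
qed

lemma order_isomorphic_4_iff:
  "order_isomorphic [a, b, c, d] [a', b', c', d'] \<longleftrightarrow>
    (a < b \<longleftrightarrow> a' < b') \<and> (a < c \<longleftrightarrow> a' < c') \<and> (a < d \<longleftrightarrow> a' < d') \<and>
    (b < a \<longleftrightarrow> b' < a') \<and> (b < c \<longleftrightarrow> b' < c') \<and> (b < d \<longleftrightarrow> b' < d') \<and>
    (c < a \<longleftrightarrow> c' < a') \<and> (c < b \<longleftrightarrow> c' < b') \<and> (c < d \<longleftrightarrow> c' < d') \<and>
    (d < a \<longleftrightarrow> d' < a') \<and> (d < b \<longleftrightarrow> d' < b') \<and> (d < c \<longleftrightarrow> d' < c')"
  unfolding order_isomorphic_def by (simp add: All_less_Suc) blast

definition has_1324 :: "nat list \<Rightarrow> bool" where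
  "has_1324 p \<longleftrightarrow> (\<exists>i j k l. i < j \<and> j < k \<and> k < l \<and> l < length p \<and>
     p ! i < p ! k \<and> p ! k < p ! j \<and> p ! j < p ! l)"

text \<open>\<open>has_132\<close> and \<open>has_213\<close> are what a 1324 leaves in one block of
  a direct sum when its 4 or its 1 may lie in the other block.\<close>

definition has_213 :: "nat list \<Rightarrow> bool" where
  "has_213 p \<longleftrightarrow> (\<exists>i j l. i < j \<and> j < l \<and> l < length p \<and> p ! j < p ! i \<and> p ! i < p ! l)"

lemma avoids_1324_4321_iff:
  "avoids p {[1,3,2,4], [4,3,2,1]} \<longleftrightarrow> \<not> has_1324 p \<and> \<not> has_4321 p"
proof -
  have "order_isomorphic [a, b, c, d] [1,3,2,4] \<longleftrightarrow> a < c \<and> c < b \<and> b < d" for a b c d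
    by (auto simp: order_isomorphic_4_iff)
  then have "contains_pattern p [1,3,2,4] \<longleftrightarrow> has_1324 p"
    by (simp add: contains_pattern_4_iff has_1324_def)
  moreover have "order_isomorphic [a, b, c, d] [4,3,2,1] \<longleftrightarrow> a > b \<and> b > c \<and> c > d" for a b c d
    by (auto simp: order_isomorphic_4_iff)
  then have "contains_pattern p [4,3,2,1] \<longleftrightarrow> has_4321 p"
    by (simp add: contains_pattern_4_iff has_4321_def)
  ultimately show ?thesis
    by (simp add: avoids_def)
qed

section \<open>Reverse-complement\<close>

definition rev_complement :: "nat list \<Rightarrow> nat list" where
  "rev_complement p = rev (map (\<lambda>x. length p + 1 - x) p)"

lemma length_rev_complement [simp]: "length (rev_complement p) = length p"
  by (simp add: rev_complement_def)

lemma rev_complement_in_perms: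
  assumes "p \<in> permutations_of_set {1..n}"
  shows "rev_complement p \<in> permutations_of_set {1..n}"
proof -
  have p: "set p = {1..n}" "distinct p" "length p = n"
    using assms length_finite_permutations_of_set[OF assms] by (auto simp: permutations_of_set_def)
  have "(\<lambda>x. n + 1 - x) ` {1..n} = {1..n}"
  proof (intro equalityI subsetI)
    fix x assume "x \<in> {1..n}"
    then show "x \<in> (\<lambda>x. n + 1 - x) ` {1..n}"
      by (intro image_eqI[of _ _ "n + 1 - x"]) auto
  qed auto
  moreover have "inj_on (\<lambda>x. n + 1 - x) {1..n}"
    by (auto simp: inj_on_def)
  ultimately show ?thesis
    using p by (auto simp: permutations_of_set_def rev_complement_def distinct_map)
qed

lemma rev_complement_rev_complement:
  assumes "p \<in> permutations_of_set {1..n}"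
  shows "rev_complement (rev_complement p) = p"
proof -
  have "length p = n" "set p = {1..n}"
    using assms length_finite_permutations_of_set[OF assms] by (auto simp: permutations_of_set_def)
  then show ?thesis
    by (auto simp: rev_complement_def rev_map comp_def intro!: map_idI)
qed

text \<open>Reversal moves position \<open>i\<close> to \<open>n - 1 - i\<close>, and complementing
  turns the order of values around. Entries are at most \<open>n\<close>, so the subtraction never
  truncates.\<close>

lemma rev_complement_less_iff:
  assumes "p \<in> permutations_of_set {1..n}" "i < n" "j < n"
  shows "rev_complement p ! i < rev_complement p ! j \<longleftrightarrow> p ! (n - 1 - j) < p ! (n - 1 - i)"
proof -
  have p: "length p = n" "set p = {1..n}"
    using assms(1) length_finite_permutations_of_set[OF assms(1)] by (auto simp: permutations_of_set_def)
  have "p ! i \<le> n" if "i < n" for i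
    using nth_mem[of i p] that p by simp
  from this[of "n - 1 - i"] this[of "n - 1 - j"] show ?thesis
    using assms p by (auto simp: rev_complement_def rev_nth)
qed

text \<open>Mirroring positions embeds the inversions of \<open>rev_complement p\<close> into those
  of \<open>p\<close>. The other inequality follows because \<open>rev_complement\<close> is an
  involution.\<close>

lemma card_inversions_rev_complement:
  assumes "p \<in> permutations_of_set {1..n}"
  shows "card (inversions (rev_complement p)) = card (inversions p)"
proof -
  have le: "card (inversions (rev_complement p)) \<le> card (inversions p)"
    if "p \<in> permutations_of_set {1..n}" for p
  proof (rule card_inj_on_le[where f = "\<lambda>(i, j). (n - 1 - j, n - 1 - i)"])
    have [simp]: "length p = n"
      using length_finite_permutations_of_set[OF that] by simp
    show "inj_on (\<lambda>(i, j). (n - 1 - j, n - 1 - i)) (inversions (rev_complement p))"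
      by (auto simp: inj_on_def inversions_def)
    show "(\<lambda>(i, j). (n - 1 - j, n - 1 - i)) ` inversions (rev_complement p) \<subseteq> inversions p"
      using rev_complement_less_iff[OF that] by (auto simp: inversions_def)
  qed simp
  show ?thesis
    using le[OF assms] le[OF rev_complement_in_perms[OF assms]] rev_complement_rev_complement[OF assms]
    by simp
qed

text \<open>Mirrored positions with flipped comparisons exchange 132 with 213 and keep 4321. Only
  the passage from \<open>rev_complement p\<close> to \<open>p\<close> is done by hand; the
  converses apply it to \<open>rev_complement p\<close>.\<close>

lemma rev_complement_patterns:
  assumes "p \<in> permutations_of_set {1..n}"
  shows "has_132 (rev_complement p) \<longleftrightarrow> has_213 p" "has_4321 (rev_complement p) \<longleftrightarrow> has_4321 p"
proof -
  have len: "length p = n" if "p \<in> permutations_of_set {1..n}" for p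
    using length_finite_permutations_of_set[OF that] by simp
  have 1: "has_213 p" if p: "p \<in> permutations_of_set {1..n}" and h: "has_132 (rev_complement p)" for p
  proof -
    obtain i j l where "i < j" "j < l" "l < n"
        "rev_complement p ! i < rev_complement p ! l" "rev_complement p ! l < rev_complement p ! j"
      using h len[OF p] unfolding has_132_def by auto
    then show ?thesis
      unfolding has_213_def using rev_complement_less_iff[OF p] len[OF p]
      by (intro exI[of _ "n - 1 - l"] exI[of _ "n - 1 - j"] exI[of _ "n - 1 - i"]) auto
  qed
  have 2: "has_132 p" if p: "p \<in> permutations_of_set {1..n}" and h: "has_213 (rev_complement p)" for p
  proof -
    obtain i j l where "i < j" "j < l" "l < n"
        "rev_complement p ! j < rev_complement p ! i" "rev_complement p ! i < rev_complement p ! l"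
      using h len[OF p] unfolding has_213_def by auto
    then show ?thesis
      unfolding has_132_def using rev_complement_less_iff[OF p] len[OF p]
      by (intro exI[of _ "n - 1 - l"] exI[of _ "n - 1 - j"] exI[of _ "n - 1 - i"]) auto
  qed
  have 3: "has_4321 p" if p: "p \<in> permutations_of_set {1..n}" and h: "has_4321 (rev_complement p)" for p
  proof -
    obtain i j k l where *: "i < j" "j < k" "k < l" "l < n"
        "rev_complement p ! j < rev_complement p ! i" "rev_complement p ! k < rev_complement p ! j"
        "rev_complement p ! l < rev_complement p ! k"
      using h len[OF p] unfolding has_4321_def by auto
    then have "n - 1 - l < n - 1 - k" "n - 1 - k < n - 1 - j" "n - 1 - j < n - 1 - i" "n - 1 - i < length p"
      using len[OF p] by linarith+
    moreover have "p ! (n - 1 - i) < p ! (n - 1 - j)" "p ! (n - 1 - j) < p ! (n - 1 - k)"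
        "p ! (n - 1 - k) < p ! (n - 1 - l)"
      using * rev_complement_less_iff[OF p, of j i] rev_complement_less_iff[OF p, of k j]
        rev_complement_less_iff[OF p, of l k] by simp_all
    ultimately show ?thesis
      unfolding has_4321_def by blast
  qed
  show "has_132 (rev_complement p) \<longleftrightarrow> has_213 p" "has_4321 (rev_complement p) \<longleftrightarrow> has_4321 p"
    using 1[of p] 2[of "rev_complement p"] 3[of p] 3[of "rev_complement p"] assms
      rev_complement_in_perms[OF assms] rev_complement_rev_complement[OF assms] by auto
qed

lemma card_perms_213_eq_132:
  "card {p \<in> permutations_of_set {1..n}. card (inversions p) = k \<and> \<not> has_213 p \<and> \<not> has_4321 p} =
   card {p \<in> permutations_of_set {1..n}. card (inversions p) = k \<and> \<not> has_132 p \<and> \<not> has_4321 p}"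
proof (rule bij_betw_same_card, rule bij_betw_Collect)
  show "bij_betw rev_complement (permutations_of_set {1..n}) (permutations_of_set {1..n})"
    by (rule bij_betw_byWitness[where f' = rev_complement])
      (use rev_complement_rev_complement rev_complement_in_perms in blast)+
qed (simp add: card_inversions_rev_complement rev_complement_patterns)

section \<open>Direct sums\<close>

definition direct_sum :: "nat list \<Rightarrow> nat list \<Rightarrow> nat list" where
  "direct_sum s t = s @ map (\<lambda>x. x + length s) t"

lemma length_direct_sum [simp]: "length (direct_sum s t) = length s + length t"
  by (simp add: direct_sum_def)

lemma direct_sum_nth:
  "i < length s \<Longrightarrow> direct_sum s t ! i = s ! i"
  "\<not> i < length s \<Longrightarrow> i < length s + length t \<Longrightarrow> direct_sum s t ! i = t ! (i - length s) + length s"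
  by (simp_all add: direct_sum_def nth_append)

lemma perms_nth_bounds:
  assumes "p \<in> permutations_of_set {1..n}" "i < n"
  shows "1 \<le> p ! i" "p ! i \<le> n"
proof -
  have "p ! i \<in> set p"
    using assms length_finite_permutations_of_set[OF assms(1)] by simp
  then show "1 \<le> p ! i" "p ! i \<le> n"
    using assms by (auto simp: permutations_of_set_def)
qed

context
  fixes s t :: "nat list" and m r :: nat
  assumes s: "s \<in> permutations_of_set {1..m}" and t: "t \<in> permutations_of_set {1..r}"
begin

private lemma len: "length s = m" "length t = r"
  using length_finite_permutations_of_set[OF s] length_finite_permutations_of_set[OF t] by simp_all

private lemma nth_left: "i < m \<Longrightarrow> direct_sum s t ! i = s ! i"
  and nth_right: "m \<le> i \<Longrightarrow> i < m + r \<Longrightarrow> direct_sum s t ! i = t ! (i - m) + m"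
  by (simp_all add: direct_sum_nth len)

text \<open>Entries of the left block are at most \<open>m\<close>, those of the right block at
  least \<open>m + 1\<close>.\<close>

private lemma less_across: "i < m \<Longrightarrow> m \<le> j \<Longrightarrow> j < m + r \<Longrightarrow> direct_sum s t ! i < direct_sum s t ! j"
  using perms_nth_bounds[OF s, of i] perms_nth_bounds[OF t, of "j - m"]
  by (simp add: nth_left nth_right less_diff_conv2 add.commute[of r])

private lemma left_if_inversion:
  "j < m + r \<Longrightarrow> direct_sum s t ! j < direct_sum s t ! i \<Longrightarrow> i < m \<Longrightarrow> j < m"
  using less_across[of i j] by (cases "j < m") auto

lemma direct_sum_in_perms: "direct_sum s t \<in> permutations_of_set {1..m + r}"
proof -
  have "(\<lambda>x. x + m) ` {1..r} = {m + 1..m + r}"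
    by (simp add: image_add_atLeastAtMost' add.commute)
  then show ?thesis
    using s t by (auto simp: permutations_of_set_def direct_sum_def len distinct_map)
qed

text \<open>No inversion joins the two blocks, so each belongs to \<open>s\<close> or is a shifted
  one of \<open>t\<close>.\<close>

lemma card_inversions_direct_sum:
  "card (inversions (direct_sum s t)) = card (inversions s) + card (inversions t)"
proof -
  let ?g = "\<lambda>(i, j). (i + m, j + m)"
  have "inversions (direct_sum s t) = inversions s \<union> ?g ` inversions t"
  proof (intro set_eqI iffI)
    fix x assume "x \<in> inversions (direct_sum s t)"
    then obtain i j where x: "x = (i, j)" "i < j" "j < m + r" "direct_sum s t ! j < direct_sum s t ! i"
      by (auto simp: inversions_def len)
    show "x \<in> inversions s \<union> ?g ` inversions t"
    proof (cases "i < m")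
      case True
      then show ?thesis
        using x left_if_inversion[of j i] by (simp add: inversions_def len nth_left)
    next
      case False
      then have "(i - m, j - m) \<in> inversions t" "x = ?g (i - m, j - m)"
        using x by (auto simp: inversions_def len nth_right)
      then show ?thesis
        by blast
    qed
  next
    fix x assume "x \<in> inversions s \<union> ?g ` inversions t"
    then show "x \<in> inversions (direct_sum s t)"
      by (auto simp: inversions_def len nth_left nth_right)
  qed
  moreover have "inversions s \<inter> ?g ` inversions t = {}"
    by (auto simp: inversions_def len)
  moreover have "card (?g ` inversions t) = card (inversions t)"
    by (rule card_image) (auto simp: inj_on_def)
  ultimately show ?thesis
    by (simp add: card_Un_disjoint)
qed

text \<open>Neighbouring entries of a 4321 form inversions, so all four lie in the block of the
  first.\<close>

lemma has_4321_direct_sum: "has_4321 (direct_sum s t) \<longleftrightarrow> has_4321 s \<or> has_4321 t"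
proof
  assume "has_4321 (direct_sum s t)"
  then obtain i j k l where *: "i < j" "j < k" "k < l" "l < m + r"
      "direct_sum s t ! j < direct_sum s t ! i" "direct_sum s t ! k < direct_sum s t ! j"
      "direct_sum s t ! l < direct_sum s t ! k"
    by (auto simp: has_4321_def len)
  show "has_4321 s \<or> has_4321 t"
  proof (cases "i < m")
    case True
    then have "j < m" "k < m" "l < m"
      using * left_if_inversion[of j i] left_if_inversion[of k j] left_if_inversion[of l k] by auto
    then have "has_4321 s"
      unfolding has_4321_def len using * True
      by (intro exI[of _ i] exI[of _ j] exI[of _ k] exI[of _ l]) (auto simp: nth_left)
    then show ?thesis ..
  next
    case False
    then have "m \<le> i" "m \<le> j" "m \<le> k" "m \<le> l"
      using * by auto
    then obtain i' j' k' l' where "i = m + i'" "j = m + j'" "k = m + k'" "l = m + l'"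
      by (auto simp: le_iff_add)
    then have "has_4321 t"
      unfolding has_4321_def len using *
      by (intro exI[of _ i'] exI[of _ j'] exI[of _ k'] exI[of _ l']) (simp add: nth_right)
    then show ?thesis ..
  qed
next
  assume "has_4321 s \<or> has_4321 t"
  then show "has_4321 (direct_sum s t)"
  proof
    assume "has_4321 s"
    then obtain i j k l where "i < j" "j < k" "k < l" "l < m" "s ! j < s ! i" "s ! k < s ! j" "s ! l < s ! k"
      by (auto simp: has_4321_def len)
    then show ?thesis
      unfolding has_4321_def
      by (intro exI[of _ i] exI[of _ j] exI[of _ k] exI[of _ l]) (auto simp: len nth_left)
  next
    assume "has_4321 t"
    then obtain i j k l where "i < j" "j < k" "k < l" "l < r" "t ! j < t ! i" "t ! k < t ! j" "t ! l < t ! k"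
      by (auto simp: has_4321_def len)
    then show ?thesis
      unfolding has_4321_def
      by (intro exI[of _ "i + m"] exI[of _ "j + m"] exI[of _ "k + m"] exI[of _ "l + m"]) (auto simp: len nth_right)
  qed
qed

text \<open>The inversion 32 of a 1324 lies in one block: in the left one 132 remains, in the right
  one 213. Conversely, the other block, being nonempty, supplies the missing entry: position
  \<open>m\<close> serves as the 4, position 0 as the 1.\<close>

lemma has_1324_direct_sum:
  assumes "m > 0" "r > 0"
  shows "has_1324 (direct_sum s t) \<longleftrightarrow> has_132 s \<or> has_213 t"
proof
  assume "has_1324 (direct_sum s t)"
  then obtain i j k l where *: "i < j" "j < k" "k < l" "l < m + r"
      "direct_sum s t ! i < direct_sum s t ! k" "direct_sum s t ! k < direct_sum s t ! j"
      "direct_sum s t ! j < direct_sum s t ! l"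
    by (auto simp: has_1324_def len)
  show "has_132 s \<or> has_213 t"
  proof (cases "j < m")
    case True
    then have "k < m"
      using * left_if_inversion[of k j] by auto
    then have "has_132 s"
      unfolding has_132_def len using * True
      by (intro exI[of _ i] exI[of _ j] exI[of _ k]) (auto simp: nth_left)
    then show ?thesis ..
  next
    case False
    then have "m \<le> j" "m \<le> k" "m \<le> l"
      using * by auto
    then obtain j' k' l' where "j = m + j'" "k = m + k'" "l = m + l'"
      by (auto simp: le_iff_add)
    then have "has_213 t"
      unfolding has_213_def len using *
      by (intro exI[of _ j'] exI[of _ k'] exI[of _ l']) (simp add: nth_right)
    then show ?thesis ..
  qed
next
  assume "has_132 s \<or> has_213 t"
  then show "has_1324 (direct_sum s t)"
  proof
    assume "has_132 s"
    then obtain i j l where "i < j" "j < l" "l < m" "s ! i < s ! l" "s ! l < s ! j"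
      by (auto simp: has_132_def len)
    then show ?thesis
      unfolding has_1324_def using less_across[of j m] assms
      by (intro exI[of _ i] exI[of _ j] exI[of _ l] exI[of _ m]) (auto simp: len nth_left)
  next
    assume "has_213 t"
    then obtain i j l where "i < j" "j < l" "l < r" "t ! j < t ! i" "t ! i < t ! l"
      by (auto simp: has_213_def len)
    then show ?thesis
      unfolding has_1324_def using less_across[of 0 "j + m"] assms
      by (intro exI[of _ 0] exI[of _ "i + m"] exI[of _ "j + m"] exI[of _ "l + m"]) (auto simp: len nth_right)
  qed
qed

end

section \<open>Splitting a 1324-avoider into two blocks\<close>

text \<open>In a 1324-avoider no inversion has both an entry to its lower left and one to its upper right.
  If there is none to the lower left of the inversion \<open>(a, b)\<close>, every position before \<open>b\<close> forms an inversion
  with \<open>a\<close> or with \<open>b\<close>.\<close>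

lemma inversion_near_ends:
  assumes d: "distinct p" and no: "\<not> has_1324 p" and inv: "(a, b) \<in> inversions p"
  shows "b \<le> card (inversions p) \<or> length p \<le> a + 1 + card (inversions p)"
proof -
  have ab: "a < b" "b < length p" "p ! b < p ! a"
    using inv by (auto simp: inversions_def)
  have ne: "p ! i \<noteq> p ! j" if "i < length p" "j < length p" "i \<noteq> j" for i j
    using d that by (simp add: nth_eq_iff_index_eq)
  have "(\<forall>i<a. p ! b < p ! i) \<or> (\<forall>l>b. l < length p \<longrightarrow> p ! l < p ! a)"
  proof (rule ccontr)
    assume "\<not> ?thesis"
    then obtain i l where il: "i < a" "\<not> p ! b < p ! i" "b < l" "l < length p" "\<not> p ! l < p ! a"
      by blast
    then have "p ! i < p ! b" "p ! a < p ! l"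
      using ne[of i b] ne[of a l] ab by auto
    then show False
      using no il ab unfolding has_1324_def by blast
  qed
  then show ?thesis
  proof (elim disjE)
    assume 1: "\<forall>i<a. p ! b < p ! i"
    \<comment> \<open>A position \<open>j < b\<close> whose entry is below \<open>p ! b\<close> must
      come after \<open>a\<close> by 1, so it forms an inversion with \<open>a\<close>. Only the
      pairs of the first kind end in \<open>b\<close>, which gives injectivity.\<close>
    define f where "f j = (if p ! b < p ! j then (j, b) else (a, j))" for j
    have "inj_on f {..<b}"
      by (auto simp: f_def inj_on_def split: if_splits)
    moreover have "f ` {..<b} \<subseteq> inversions p"
    proof (rule image_subsetI)
      fix j assume "j \<in> {..<b}"
      then show "f j \<in> inversions p"
        using ab 1 by (cases j a rule: linorder_cases) (auto simp: f_def inversions_def)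
    qed
    ultimately have "card {..<b} \<le> card (inversions p)"
      by (rule card_inj_on_le) simp
    then show ?thesis
      by simp
  next
    assume 2: "\<forall>l>b. l < length p \<longrightarrow> p ! l < p ! a"
    \<comment> \<open>The mirror image: now the positions after \<open>a\<close> are assigned to
      inversions.\<close>
    define f where "f j = (if p ! j < p ! a then (a, j) else (j, b))" for j
    have "inj_on f {a<..<length p}"
      by (auto simp: f_def inj_on_def split: if_splits)
    moreover have "f ` {a<..<length p} \<subseteq> inversions p"
    proof (rule image_subsetI)
      fix j assume "j \<in> {a<..<length p}"
      then show "f j \<in> inversions p"
        using ab 2 by (cases j b rule: linorder_cases) (auto simp: f_def inversions_def)
    qed
    ultimately have "card {a<..<length p} \<le> card (inversions p)"
      by (rule card_inj_on_le) simp
    then have "length p - Suc a \<le> card (inversions p)"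
      by simp
    then show ?thesis
      by linarith
  qed
qed

text \<open>With no inversion across the cut, each of the first \<open>m\<close> entries is below
  each later one. So their values form an initial segment of \<open>{1..m + r}\<close>, which has
  \<open>m\<close> elements and thus is \<open>{1..m}\<close>.\<close>

lemma direct_sum_if_no_crossing_inversion:
  assumes p: "p \<in> permutations_of_set {1..m + r}"
    and no: "\<And>a b. (a, b) \<in> inversions p \<Longrightarrow> b < m \<or> m \<le> a"
  obtains s t where "s \<in> permutations_of_set {1..m}" "t \<in> permutations_of_set {1..r}" "p = direct_sum s t"
proof -
  have len: "length p = m + r" and set: "set p = {1..m + r}" and d: "distinct p"
    using p length_finite_permutations_of_set[OF p] by (auto simp: permutations_of_set_def)
  define A B where "A = set (take m p)" and "B = set (drop m p)"
  have AB: "A \<union> B = {1..m + r}" "A \<inter> B = {}"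
    unfolding A_def B_def using set d
    by (metis append_take_drop_id set_append, metis append_take_drop_id distinct_append d)
  have cards: "card A = m" "card B = r"
    unfolding A_def B_def using d len by (simp_all add: distinct_card)
  have less: "x < y" if "x \<in> A" "y \<in> B" for x y
  proof (rule ccontr)
    assume "\<not> x < y"
    obtain i where i: "i < m" "x = p ! i"
      using \<open>x \<in> A\<close> len by (auto simp: A_def in_set_conv_nth)
    obtain j where j: "j < r" "y = p ! (m + j)"
      using \<open>y \<in> B\<close> len by (auto simp: B_def in_set_conv_nth)
    have "(i, m + j) \<in> inversions p"
      using \<open>\<not> x < y\<close> i j len d by (auto simp: inversions_def not_less order_le_less nth_eq_iff_index_eq)
    then show False
      using no[of i "m + j"] i by simp
  qed
  have "A \<subseteq> {1..m}"
  proof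
    fix x assume x: "x \<in> A"
    \<comment> \<open>All of \<open>B\<close> lies above \<open>x\<close>, so the values up to
      \<open>x\<close> are in \<open>A\<close>, and counting them gives
      \<open>x <= m\<close>.\<close>
    have "{1..x} \<subseteq> A"
    proof
      fix z assume z: "z \<in> {1..x}"
      have "x \<le> m + r"
        using x AB(1) by auto
      then have "z \<in> A \<union> B" "z \<notin> B"
        unfolding AB(1) using x z less[of x z] by auto
      then show "z \<in> A"
        by blast
    qed
    then have "card {1..x} \<le> card A"
      by (intro card_mono) (simp_all add: A_def)
    then show "x \<in> {1..m}"
      using x AB cards by auto
  qed
  then have A: "A = {1..m}"
    by (rule card_subset_eq[rotated]) (simp_all add: cards)
  then have B: "B = {m + 1..m + r}"
  proof -
    have "B = {1..m + r} - {1..m}"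
      using AB A by blast
    then show ?thesis
      by auto
  qed
  define t where "t = map (\<lambda>x. x - m) (drop m p)"
  have "set t = {1..r}"
  proof -
    have "(\<lambda>x. x - m) ` {m + 1..m + r} = {1..r}"
    proof (intro equalityI subsetI)
      fix x assume "x \<in> {1..r}"
      then show "x \<in> (\<lambda>x. x - m) ` {m + 1..m + r}"
        by (intro image_eqI[of _ _ "x + m"]) auto
    qed auto
    then show ?thesis
      using B by (simp add: t_def B_def)
  qed
  moreover have "distinct t"
    using d B by (auto simp: t_def B_def distinct_map inj_on_def)
  moreover have "p = direct_sum (take m p) t"
  proof -
    have "map (\<lambda>x. x - m + m) (drop m p) = drop m p"
      using B by (intro map_idI) (auto simp: B_def)
    then show ?thesis
      using len by (simp add: direct_sum_def t_def comp_def)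
  qed
  ultimately show thesis
    using A d by (intro that[of "take m p" t]) (auto simp: permutations_of_set_def A_def)
qed

subsection \<open>The limit sequence\<close>

lemma av_1324_4321:
  assumes "n \<ge> 2 * k + 2"
  shows "av n k {[1,3,2,4], [4,3,2,1]} = (\<Sum>i\<le>k. parts_le2 i * parts_le2 (k - i))"
proof -
  \<comment> \<open>Both blocks get more than \<open>k\<close> entries, as the count by padded
    partitions requires for every number of inversions up to \<open>k\<close>.\<close>
  define m r where "m = k + 1" and "r = n - m"
  have mr: "m + r = n" "k < m" "k < r"
    using assms by (simp_all add: m_def r_def)
  define L where "L i = {s \<in> permutations_of_set {1..m}. card (inversions s) = i \<and> \<not> has_132 s \<and> \<not> has_4321 s}" for i
  define R where "R j = {t \<in> permutations_of_set {1..r}. card (inversions t) = j \<and> \<not> has_213 t \<and> \<not> has_4321 t}" for j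
  define X where "X = {p \<in> permutations_of_set {1..n}. card (inversions p) = k \<and> \<not> has_1324 p \<and> \<not> has_4321 p}"
  have cardL: "card (L i) = parts_le2 i" if "i \<le> k" for i
  proof -
    have "i < m"
      using that mr by simp
    show ?thesis
      unfolding L_def card_perms_eq_card_parts[OF \<open>i < m\<close>] by (rule card_padded_parts_le2[OF \<open>i < m\<close>])
  qed
  have cardR: "card (R j) = parts_le2 j" if "j \<le> k" for j
  proof -
    have "j < r"
      using that mr by simp
    show ?thesis
      unfolding R_def card_perms_213_eq_132 card_perms_eq_card_parts[OF \<open>j < r\<close>]
      by (rule card_padded_parts_le2[OF \<open>j < r\<close>])
  qed
  have fin: "finite (L i)" "finite (R i)" for i
    by (simp_all add: L_def R_def)
  let ?U = "\<Union>i\<le>k. L i \<times> R (k - i)"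
  have "bij_betw (\<lambda>(s, t). direct_sum s t) ?U X"
  proof (rule bij_betw_imageI)
    show "inj_on (\<lambda>(s, t). direct_sum s t) ?U"
    proof (rule inj_onI, clarify)
      fix s t s' t' i i'
      assume *: "s \<in> L i" "s' \<in> L i'" "direct_sum s t = direct_sum s' t'"
      \<comment> \<open>The cut is at the same place in all pairs, so the concatenation can be
        undone.\<close>
      have "length s = m" "length s' = m"
        using *(1,2) length_finite_permutations_of_set[of _ "{1..m}"] by (auto simp: L_def)
      then show "s = s' \<and> t = t'"
        using *(3) inj_map_eq_map[of "\<lambda>x. x + m" t t'] by (simp add: direct_sum_def inj_on_def)
    qed
    show "(\<lambda>(s, t). direct_sum s t) ` ?U = X"
    proof (intro equalityI subsetI)
      fix p assume "p \<in> (\<lambda>(s, t). direct_sum s t) ` ?U"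
      then obtain i s t where *: "i \<le> k" "s \<in> L i" "t \<in> R (k - i)" "p = direct_sum s t"
        by auto
      then have s: "s \<in> permutations_of_set {1..m}" and t: "t \<in> permutations_of_set {1..r}"
        by (simp_all add: L_def R_def)
      show "p \<in> X"
        using * direct_sum_in_perms[OF s t] card_inversions_direct_sum[OF s t]
          has_4321_direct_sum[OF s t] has_1324_direct_sum[OF s t] mr
        by (simp add: X_def L_def R_def)
    next
      fix p assume "p \<in> X"
      then have p: "p \<in> permutations_of_set {1..m + r}" "card (inversions p) = k"
          "\<not> has_1324 p" "\<not> has_4321 p"
        by (simp_all add: X_def mr)
      have "length p = m + r" "distinct p"
        using p(1) length_finite_permutations_of_set[OF p(1)] by (auto simp: permutations_of_set_def)
      \<comment> \<open>The alternatives \<open>b <= k\<close> and \<open>n <= a + 1 + k\<close>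
        become \<open>b < m\<close> and, by \<open>n >= 2 * k + 2\<close>,
        \<open>a >= k + 1 = m\<close>.\<close>
      then have "b < m \<or> m \<le> a" if "(a, b) \<in> inversions p" for a b
        using inversion_near_ends[of p a b] that p(2,3) mr by (auto simp: m_def)
      then obtain s t where st: "s \<in> permutations_of_set {1..m}" "t \<in> permutations_of_set {1..r}"
          "p = direct_sum s t"
        using direct_sum_if_no_crossing_inversion[OF p(1)] by blast
      have "card (inversions s) + card (inversions t) = k" "\<not> has_132 s" "\<not> has_213 t"
          "\<not> has_4321 s" "\<not> has_4321 t"
        using p card_inversions_direct_sum[OF st(1,2)] has_4321_direct_sum[OF st(1,2)]
          has_1324_direct_sum[OF st(1,2)] mr unfolding st(3) by simp_all
      then have "card (inversions s) \<le> k" "s \<in> L (card (inversions s))" "t \<in> R (k - card (inversions s))"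
        using st by (auto simp: L_def R_def)
      then show "p \<in> (\<lambda>(s, t). direct_sum s t) ` ?U"
        unfolding st(3) by (intro image_eqI[of _ _ "(s, t)"]) auto
    qed
  qed
  then have "card X = card ?U"
    by (simp add: bij_betw_same_card)
  also have "\<dots> = (\<Sum>i\<le>k. card (L i \<times> R (k - i)))"
    by (rule card_UN_disjoint) (auto simp: fin, auto simp: L_def)
  also have "\<dots> = (\<Sum>i\<le>k. parts_le2 i * parts_le2 (k - i))"
    by (intro sum.cong) (simp_all add: card_cartesian_product cardL cardR)
  finally show ?thesis
    unfolding av_def avoids_1324_4321_iff X_def .
qed

text \<open>Two eventual values agree at an index beyond both thresholds, so the \<open>THE\<close>
  in the definition has a unique candidate.\<close>

lemma limit_sequence_eqI:
  assumes "\<And>n. n \<ge> m \<Longrightarrow> av n k B = c"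
  shows "limit_sequence B k = c"
  unfolding limit_sequence_def
proof (rule the_equality)
  fix c' assume "\<exists>m. \<forall>n\<ge>m. av n k B = c'"
  then obtain m' where "\<And>n. n \<ge> m' \<Longrightarrow> av n k B = c'"
    by blast
  then show "c' = c"
    using assms[of "max m m'"] by simp
qed (use assms in blast)

theorem proposition5p10:
  fixes B :: "nat list set"
  defines "B \<equiv> {[1,3,2,4], [4,3,2,1]}"
  shows "has_limit_sequence B \<and>
    limit_gf B =
      (1 + (\<Sum>\<^sub>\<infinity>k\<in>{1..}. fps_X ^ k / (1 - fps_X ^ k))
         + (\<Sum>\<^sub>\<infinity>k\<in>{1..}. \<Sum>\<^sub>\<infinity>i\<in>{k+1..}.
              fps_X ^ (k + i) / ((1 - fps_X ^ k) * (1 - fps_X ^ i)))) ^ 2"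
proof
  show "has_limit_sequence B"
    unfolding has_limit_sequence_def B_def using av_1324_4321 by blast
  have "limit_sequence B k = (\<Sum>i\<le>k. parts_le2 i * parts_le2 (k - i))" for k
    unfolding B_def by (rule limit_sequence_eqI) (rule av_1324_4321)
  \<comment> \<open>The convolution sum is the coefficient of a square.\<close>
  then have "limit_gf B = (Abs_fps (\<lambda>n. of_nat (parts_le2 n))) ^ 2"
    by (intro fps_ext) (simp add: limit_gf_def power2_eq_square fps_mult_nth atLeast0AtMost)
  then show "limit_gf B =
      (1 + (\<Sum>\<^sub>\<infinity>k\<in>{1..}. fps_X ^ k / (1 - fps_X ^ k))
         + (\<Sum>\<^sub>\<infinity>k\<in>{1..}. \<Sum>\<^sub>\<infinity>i\<in>{k+1..}.
              fps_X ^ (k + i) / ((1 - fps_X ^ k) * (1 - fps_X ^ i)))) ^ 2"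
    unfolding parts_le2_gf .
qed

end
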